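(* Let $\mu$ be a doubling measure on $\mathbb{R}$ (with doubling constant $\delta$). Let $u,v\colon\mathbb{R}\to\mathbb{R}$ be such that $u'=\mu$ in the sense of distributions (i.e. $u(b)-u(a)=\mu([a,b])$ for $a<b$) and $v\in\Lambda_\mu$. Then the image of $\mathbb{R}$ under $\Gamma(t)=u(t)+iv(t)$ is a quasisymmetric graph. Moreover, for every $s>0$ there is $\varepsilon>0$ such that if $\delta\le\varepsilon$ and the $\Lambda_\mu$-seminorm of $v$ is at most $\varepsilon$, then $\Gamma(\mathbb{R})$ is an $s$-quasisymmetric graph.
   Context: A positive Radon measure $\mu$ on $\mathbb{R}$ is doubling if there is $\delta>0$ with $\mu(I)\le(1+\delta)\mu(J)$ for all adjacent intervals $I,J$ of equal length; such a measure is nonatomic. For a nonatomic positive Radon measure $\mu$ on $\mathbb{R}$, the generalized Zygmund class $\Lambda_\mu$ consists of continuous $g\colon\mathbb{R}\to\mathbb{R}$ for which there is $M>0$ with $|g(x+h)-2g(x)+g(x-h)|\le M\mu([x-h,x+h])$ for all $x\in\mathbb{R}$, $h\ge0$; the smallest such $M$ is the $\Lambda_\mu$-seminorm of $g$. An embedding $f$ is quasisymmetric if there is a homeomorphism $\eta\colon[0,\infty)\to[0,\infty)$ with $|f(x)-f(a)|\le\eta(|x-a|/|x-b|)\,|f(x)-f(b)|$ for all distinct $a,b,x$; it is $s$-quasisymmetric if $\eta$ can be chosen with $\eta(t)\le t+s$ for $0\le t\le1/s$. A set $\Gamma\subset\mathbb{C}$ is a quasisymmetric (resp. $s$-quasisymmetric)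 graph if the projection $w\mapsto\operatorname{Re} w$ is a quasisymmetric (resp. $s$-quasisymmetric) homeomorphism of $\Gamma$ onto $\mathbb{R}$. *)

theory Defs
  imports "HOL-Analysis.Analysis"
begin

definition radon_measure :: "real measure \<Rightarrow> bool" where
  "radon_measure M \<longleftrightarrow> sets M = sets borel \<and> (\<forall>K. compact K \<longrightarrow> emeasure M K < \<infinity>)"

definition doubling :: "real measure \<Rightarrow> real \<Rightarrow> bool" where
  "doubling M \<delta> \<longleftrightarrow> \<delta> > 0 \<and>
     (\<forall>a b c. a < b \<and> c - b = b - a \<longrightarrow>
        measure M {a..b} \<le> (1 + \<delta>) * measure M {b..c} \<and>
        measure M {b..c} \<le> (1 + \<delta>) * measure M {a..b})"

definition zygmund_bound :: "real measure \<Rightarrow> (real \<Rightarrow> real) \<Rightarrow> real \<Rightarrow> bool" where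
  "zygmund_bound M g C \<longleftrightarrow>
     (\<forall>x h. h \<ge> 0 \<longrightarrow> \<bar>g (x + h) - 2 * g x + g (x - h)\<bar> \<le> C * measure M {x - h..x + h})"

definition zygmund_class :: "real measure \<Rightarrow> (real \<Rightarrow> real) set" where
  "zygmund_class M = {g. continuous_on UNIV g \<and> (\<exists>C>0. zygmund_bound M g C)}"

definition zygmund_seminorm :: "real measure \<Rightarrow> (real \<Rightarrow> real) \<Rightarrow> real" where
  "zygmund_seminorm M g = Inf {C. C > 0 \<and> zygmund_bound M g C}"

definition halfline_homeo :: "(real \<Rightarrow> real) \<Rightarrow> bool" where
  "halfline_homeo \<eta> \<longleftrightarrow> (\<exists>\<eta>'. homeomorphism {0..} {0..} \<eta> \<eta>')"

definition qs_inequality ::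
    "'a::metric_space set \<Rightarrow> ('a \<Rightarrow> 'b::metric_space) \<Rightarrow> (real \<Rightarrow> real) \<Rightarrow> bool" where
  "qs_inequality S f \<eta> \<longleftrightarrow>
     (\<forall>a\<in>S. \<forall>b\<in>S. \<forall>x\<in>S. a \<noteq> b \<and> a \<noteq> x \<and> b \<noteq> x \<longrightarrow>
        dist (f x) (f a) \<le> \<eta> (dist x a / dist x b) * dist (f x) (f b))"

definition quasisymmetric :: "'a::metric_space set \<Rightarrow> ('a \<Rightarrow> 'b::metric_space) \<Rightarrow> bool" where
  "quasisymmetric S f \<longleftrightarrow> (\<exists>\<eta>. halfline_homeo \<eta> \<and> qs_inequality S f \<eta>)"

definition s_quasisymmetric ::
    "real \<Rightarrow> 'a::metric_space set \<Rightarrow> ('a \<Rightarrow> 'b::metric_space) \<Rightarrow> bool" where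
  "s_quasisymmetric s S f \<longleftrightarrow>
     (\<exists>\<eta>. halfline_homeo \<eta> \<and> (\<forall>t. 0 \<le> t \<and> t \<le> 1 / s \<longrightarrow> \<eta> t \<le> t + s) \<and> qs_inequality S f \<eta>)"

definition qs_graph :: "complex set \<Rightarrow> bool" where
  "qs_graph \<Gamma> \<longleftrightarrow> (\<exists>g. homeomorphism \<Gamma> UNIV Re g) \<and> quasisymmetric \<Gamma> Re"

definition s_qs_graph :: "real \<Rightarrow> complex set \<Rightarrow> bool" where
  "s_qs_graph s \<Gamma> \<longleftrightarrow> (\<exists>g. homeomorphism \<Gamma> UNIV Re g) \<and> s_quasisymmetric s \<Gamma> Re"

end

theory Submission
  imports Defs
begin

text \<open>The projection of the graph onto the real axis is \<open>u \<circ> \<Gamma>\<inverse>\<close>, so increments of \<open>u\<close> are to be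
  compared with increments of \<open>\<Gamma> = u + i v\<close>. Both functions \<open>g = u\<close> and \<open>g = \<Gamma>\<close> satisfy
  \<open>|g (x + h) - 2 g x + g (x - h)| \<le> A (u (x + h) - u (x - h))\<close> with \<open>A = \<delta> + C\<close>.
  A maximum principle shows that the error of linear interpolation of such a \<open>g\<close> is at most a constant
  times \<open>A\<close> times the increment of \<open>u\<close>, hence of \<open>g\<close>. If \<open>A\<close> is small, the ratios of increments of
  \<open>u\<close> and of \<open>\<Gamma>\<close> are therefore both close to the ratio of the steps, which gives the second
  claim for ratios up to \<open>2 / s\<close>. In general, increments of both functions grow at most
  and decay at least geometrically under doubling and halving of the step, so that one ratio is
  bounded by a sum of two powers of the other.\<close>

section \<open>Linear interpolation under a bound on second differences\<close>

text \<open>Subtracting the chord leaves a function \<open>G\<close> that vanishes at both ends and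
  has the second differences of \<open>g\<close>. At a maximum point \<open>z\<close> of its norm, a
  step to the nearer end makes one neighbour value zero and leaves the other at most the maximum, so
  \<open>2 * norm (G z)\<close> exceeds \<open>norm (G z)\<close> by at most the second-difference
  bound.\<close>

lemma zygmund_chord:
  fixes u :: "real \<Rightarrow> real" and g :: "real \<Rightarrow> 'a::real_normed_vector"
  assumes "mono u" "continuous_on UNIV g" "A \<ge> 0"
    and zyg: "\<And>x h. h \<ge> 0 \<Longrightarrow> norm (g (x + h) - 2 *\<^sub>R g x + g (x - h)) \<le> A * (u (x + h) - u (x - h))"
    and "a < b" "a \<le> y" "y \<le> b"
  shows "norm (g y - g a - ((y - a) / (b - a)) *\<^sub>R (g b - g a)) \<le> A * (u b - u a)"
proof -
  define G where "G t = g t - g a - ((t - a) / (b - a)) *\<^sub>R (g b - g a)" for t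
  have ends: "G a = 0" "G b = 0" using \<open>a < b\<close> by (auto simp: G_def)
  have "continuous_on {a..b} g"
    using assms(2) continuous_on_subset by blast
  then have "continuous_on {a..b} (\<lambda>t. norm (G t))"
    unfolding G_def using \<open>a < b\<close> by (intro continuous_intros) auto
  then obtain z where z: "z \<in> {a..b}" and zmax: "\<And>t. t \<in> {a..b} \<Longrightarrow> norm (G t) \<le> norm (G z)"
    using continuous_attains_sup[of "{a..b}" "\<lambda>t. norm (G t)"] \<open>a < b\<close> by auto
  have second: "G (t + h) - 2 *\<^sub>R G t + G (t - h) = g (t + h) - 2 *\<^sub>R g t + g (t - h)" for t h
  proof -
    define p q where "p = (t - a) / (b - a)" and "q = h / (b - a)"
    have pq: "(t + h - a) / (b - a) = p + q" "(t - h - a) / (b - a) = p - q"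
      by (simp_all add: p_def q_def add_divide_distrib diff_divide_distrib)
    show ?thesis
      unfolding G_def pq p_def[symmetric]
      by (simp add: scaleR_2 scaleR_add_left scaleR_diff_left)
  qed
  have key: "norm (G z) \<le> A * (u b - u a)"
    if "h \<ge> 0" "a \<le> z - h" "z + h \<le> b" "G (z + h) = 0 \<or> G (z - h) = 0" for h
  proof -
    have "norm (G (z + h) - 2 *\<^sub>R G z + G (z - h)) \<le> A * (u (z + h) - u (z - h))"
      unfolding second using zyg \<open>h \<ge> 0\<close> by blast
    also have "\<dots> \<le> A * (u b - u a)"
      using that \<open>A \<ge> 0\<close> by (intro mult_left_mono diff_mono monoD[OF \<open>mono u\<close>]) auto
    finally have 1: "norm (G (z + h) - 2 *\<^sub>R G z + G (z - h)) \<le> A * (u b - u a)" .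
    have 2: "norm (G (z + h) + G (z - h)) \<le> norm (G z)"
      using that zmax[of "z + h"] zmax[of "z - h"] by auto
    have "2 * norm (G z) = norm ((G (z + h) + G (z - h)) - (G (z + h) - 2 *\<^sub>R G z + G (z - h)))"
      by simp
    also have "\<dots> \<le> norm (G z) + A * (u b - u a)"
      using norm_triangle_ineq4[of "G (z + h) + G (z - h)" "G (z + h) - 2 *\<^sub>R G z + G (z - h)"] 1 2
      by linarith
    finally show ?thesis by simp
  qed
  have "norm (G z) \<le> A * (u b - u a)"
  proof (cases "z \<le> (a + b) / 2")
    case True
    then show ?thesis using z ends by (intro key[of "z - a"]) auto
  next
    case False
    then show ?thesis using z ends by (intro key[of "b - z"]) auto
  qed
  moreover have "norm (G y) \<le> norm (G z)" using zmax assms by simp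
  ultimately show ?thesis unfolding G_def by linarith
qed

section \<open>Gauges on the half-line and the modification for small ratios\<close>

text \<open>A form of \<open>halfline_homeo\<close> that names no inverse and keeps strict
  monotonicity at hand, so that gauges can be built by sums, products and minima.\<close>

definition halfline_gauge :: "(real \<Rightarrow> real) \<Rightarrow> bool" where
  "halfline_gauge \<eta> \<longleftrightarrow> continuous_on {0..} \<eta> \<and> strict_mono_on {0..} \<eta> \<and> \<eta> 0 = 0 \<and>
     (\<forall>B. \<exists>t\<ge>0. B \<le> \<eta> t)"

lemma halfline_gauge_homeo:
  assumes "halfline_gauge \<eta>"
  shows "halfline_homeo \<eta>"
proof -
  have cont: "continuous_on {0..} \<eta>" and mono: "strict_mono_on {0..} \<eta>" and "\<eta> 0 = 0"
    and unb: "\<And>B. \<exists>t\<ge>0. B \<le> \<eta> t"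
    using assms by (auto simp: halfline_gauge_def)
  have "\<eta> ` {0..} = {0..}"
  proof (intro equalityI subsetI)
    fix y assume "y \<in> \<eta> ` {0..}"
    then show "y \<in> {0..}"
      using strict_mono_on_leD[OF mono, of 0] \<open>\<eta> 0 = 0\<close> by auto
  next
    fix y :: real assume "y \<in> {0..}"
    obtain t where t: "t \<ge> 0" "y \<le> \<eta> t" using unb by blast
    have "continuous_on {0..t} \<eta>" using cont by (rule continuous_on_subset) auto
    then obtain x where "0 \<le> x" "\<eta> x = y"
      using IVT'[of \<eta> 0 y t] t \<open>y \<in> {0..}\<close> \<open>\<eta> 0 = 0\<close> by auto
    then show "y \<in> \<eta> ` {0..}" by auto
  qed
  then show ?thesis
    unfolding halfline_homeo_def
    using cont strict_mono_on_imp_inj_on[OF mono]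
    by (intro homeomorphism_into_1d) (auto simp: convex_imp_path_connected)
qed

lemma halfline_gauge_powr:
  assumes "a > 0" "b > 0" "p > 0" "q > 0" "H > 0"
  shows "halfline_gauge (\<lambda>t. a * (H * t) powr p + b * (H * t) powr q)"
  unfolding halfline_gauge_def
proof (intro conjI allI)
  show "continuous_on {0..} (\<lambda>t. a * (H * t) powr p + b * (H * t) powr q)"
    using assms by (intro continuous_intros continuous_on_powr') auto
  show "strict_mono_on {0..} (\<lambda>t. a * (H * t) powr p + b * (H * t) powr q)"
    using assms by (intro strict_mono_onI add_strict_mono mult_strict_left_mono powr_less_mono2) auto
  show "\<exists>t\<ge>0. B \<le> a * (H * t) powr p + b * (H * t) powr q" for B
  proof (intro exI conjI)
    \<comment> \<open>At this point the first summand equals \<open>\<bar>B\<bar>\<close>.\<close>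
    let ?t = "(\<bar>B\<bar> / a) powr (1 / p) / H"
    show "?t \<ge> 0" using assms by simp
    have "a * (H * ?t) powr p = \<bar>B\<bar>"
      using assms by (simp add: powr_powr)
    moreover have "b * (H * ?t) powr q \<ge> 0" using assms by simp
    ultimately show "B \<le> a * (H * ?t) powr p + b * (H * ?t) powr q" by linarith
  qed
qed (use assms in auto)

text \<open>The gauge must be continuous and increasing, so it cannot jump from \<open>t + s\<close>
  to \<open>\<eta> t\<close>. The transition takes place between \<open>1 / s\<close> and
  \<open>2 / s\<close>, which is why the sharp estimate is required up to ratio
  \<open>2 / s\<close>.\<close>

lemma s_quasisymmetricI:
  assumes "s > 0" and \<eta>: "halfline_gauge \<eta>" and qs: "qs_inequality S f \<eta>"
    and near: "\<And>a b x. \<lbrakk>a \<in> S; b \<in> S; x \<in> S; a \<noteq> b; a \<noteq> x; b \<noteq> x; dist x a \<le> 2 / s * dist x b\<rbrakk>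
      \<Longrightarrow> dist (f x) (f a) \<le> (dist x a / dist x b + s) * dist (f x) (f b)"
  shows "s_quasisymmetric s S f"
proof -
  have cont: "continuous_on {0..} \<eta>" and mono: "strict_mono_on {0..} \<eta>" and \<eta>0: "\<eta> 0 = 0"
    and unb: "\<And>B. \<exists>t\<ge>0. B \<le> \<eta> t"
    using \<eta> by (auto simp: halfline_gauge_def)
  have nonneg: "\<eta> t \<ge> 0" if "t \<ge> 0" for t
    using strict_mono_on_leD[OF mono, of 0 t] that \<eta>0 by simp
  \<comment> \<open>The minimum gives the value 0 at 0. The added term vanishes up to
    \<open>1 / s\<close>, and its factor is at least 1 from \<open>2 / s\<close> on, where it alone
    dominates \<open>\<eta>\<close>.\<close>
  define \<theta> where "\<theta> t = min (t + s) (\<eta> t) + max 0 (s * t - 1) * \<eta> t" for t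
  have large: "\<eta> t \<le> \<theta> t" if "t \<ge> 0" "2 / s \<le> t \<or> \<eta> t \<le> t + s" for t
  proof (cases "\<eta> t \<le> t + s")
    case True
    have "max 0 (s * t - 1) * \<eta> t \<ge> 0" using nonneg that by simp
    then show ?thesis using True by (simp add: \<theta>_def)
  next
    case False
    then have "1 \<le> max 0 (s * t - 1)" using that \<open>s > 0\<close> by (simp add: field_simps)
    then have "1 * \<eta> t \<le> max 0 (s * t - 1) * \<eta> t"
      using nonneg that by (intro mult_right_mono) auto
    moreover have "min (t + s) (\<eta> t) \<ge> 0" using that nonneg \<open>s > 0\<close> by simp
    ultimately show ?thesis unfolding \<theta>_def by linarith
  qed
  have "halfline_gauge \<theta>"
    unfolding halfline_gauge_def
  proof (intro conjI allI)
    show "continuous_on {0..} \<theta>"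
      unfolding \<theta>_def using cont by (intro continuous_intros) auto
    show "strict_mono_on {0..} \<theta>"
    proof (rule strict_mono_onI)
      fix t t' :: real assume t: "t \<in> {0..}" "t' \<in> {0..}" "t < t'"
      then have less: "\<eta> t < \<eta> t'" using mono by (simp add: strict_mono_onD)
      have "s * t \<le> s * t'" using t \<open>s > 0\<close> by simp
      then have "max 0 (s * t - 1) * \<eta> t \<le> max 0 (s * t' - 1) * \<eta> t'"
        using less nonneg t by (intro mult_mono) auto
      moreover have "min (t + s) (\<eta> t) < min (t' + s) (\<eta> t')" using less t by auto
      ultimately show "\<theta> t < \<theta> t'" unfolding \<theta>_def by linarith
    qed
    show "\<theta> 0 = 0" using \<eta>0 \<open>s > 0\<close> by (simp add: \<theta>_def)
    show "\<exists>t\<ge>0. B \<le> \<theta> t" for B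
    proof -
      obtain t where t: "t \<ge> 0" "B \<le> \<eta> t" using unb by blast
      have "\<eta> t \<le> \<eta> (max t (2 / s))" using t by (intro strict_mono_on_leD[OF mono]) auto
      also have "\<dots> \<le> \<theta> (max t (2 / s))" using t by (intro large) auto
      finally show ?thesis using t by (intro exI[of _ "max t (2 / s)"]) auto
    qed
  qed
  moreover have "\<theta> t \<le> t + s" if "0 \<le> t" "t \<le> 1 / s" for t
  proof -
    have "max 0 (s * t - 1) = 0" using that \<open>s > 0\<close> by (simp add: field_simps)
    then show ?thesis by (simp add: \<theta>_def)
  qed
  moreover have "qs_inequality S f \<theta>"
    unfolding qs_inequality_def
  proof (intro ballI impI)
    fix a b x assume S: "a \<in> S" "b \<in> S" "x \<in> S" and ne: "a \<noteq> b \<and> a \<noteq> x \<and> b \<noteq> x"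
    let ?t = "dist x a / dist x b"
    have "dist (f x) (f a) \<le> \<eta> ?t * dist (f x) (f b)"
      using qs S ne unfolding qs_inequality_def by blast
    moreover have "dist (f x) (f a) \<le> (?t + s) * dist (f x) (f b)" if "?t < 2 / s"
    proof (rule near)
      have "dist x b > 0" using ne by (simp add: eq_commute)
      then show "dist x a \<le> 2 / s * dist x b" using that by (simp only: pos_divide_less_eq less_imp_le)
    qed (use S ne in auto)
    moreover have "?t \<ge> 0" by simp
    moreover have "min (?t + s) (\<eta> ?t) \<le> \<theta> ?t"
      using nonneg[of ?t] by (simp add: \<theta>_def)
    \<comment> \<open>Below \<open>2 / s\<close> both estimates hold, and the minimum is one of
      their two factors; from \<open>2 / s\<close> on, \<open>\<eta> ?t\<close> itself lies below
      \<open>\<theta> ?t\<close>.\<close>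
    ultimately have "\<exists>c\<le>\<theta> ?t. dist (f x) (f a) \<le> c * dist (f x) (f b)"
      using large[of ?t] by (metis min_def not_le)
    then show "dist (f x) (f a) \<le> \<theta> ?t * dist (f x) (f b)"
      by (meson mult_right_mono order_trans zero_le_dist)
  qed
  ultimately show ?thesis
    unfolding s_quasisymmetric_def using halfline_gauge_homeo by blast
qed

section \<open>From dyadic growth and decay to power bounds\<close>

lemma dyadic_bracket:
  fixes y :: real
  assumes "y \<ge> 1"
  obtains n where "2 ^ n \<le> y" "y \<le> 2 ^ Suc n"
proof -
  let ?P = "\<lambda>n. y \<le> 2 ^ Suc n"
  obtain m where "y < 2 ^ m" using real_arch_pow[of 2 y] by auto
  then have ex: "?P m" by (simp add: less_imp_le order.trans[of y "2 ^ m"])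
  \<comment> \<open>Minimality yields the lower bound, except for \<open>n = 0\<close>, where it is
    the assumption on \<open>y\<close>.\<close>
  define n where "n = (LEAST n. ?P n)"
  have "?P n" unfolding n_def using ex by (rule LeastI)
  moreover have "2 ^ n \<le> y"
  proof (cases n)
    case (Suc j)
    then have "\<not> ?P j" using not_less_Least[of j ?P] unfolding n_def by simp
    then show ?thesis using Suc by simp
  qed (use assms in simp)
  ultimately show thesis using that by blast
qed

text \<open>Here \<open>y\<close> is the ratio of two steps in the parameter, \<open>r\<close> and \<open>t\<close> are the corresponding ratios
  of increments of two functions, and the exponents are chosen so that
  \<open>(1 / \<kappa>) powr p = L\<close> and \<open>(1 / L) powr (1 / p) = \<kappa>\<close>.\<close>

lemma dyadic_powr_bound:
  fixes y r t H L \<kappa> :: real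
  assumes "0 < \<kappa>" "\<kappa> < 1" "L > 1" "H \<ge> 1" "y > 0" "t > 0"
    and r_grow: "\<And>n. y \<le> 2 ^ n \<Longrightarrow> r \<le> H * L ^ n"
    and t_shrink: "\<And>n. 2 ^ n \<le> y \<Longrightarrow> 1 / t \<le> H * \<kappa> ^ n"
    and r_shrink: "\<And>n. 2 ^ n \<le> 1 / y \<Longrightarrow> r \<le> H * \<kappa> ^ n"
    and t_grow: "\<And>n. 1 / y \<le> 2 ^ n \<Longrightarrow> 1 / t \<le> H * L ^ n"
    and p: "p = ln L / ln (1 / \<kappa>)"
  shows "r \<le> H * L * (H * t) powr p + H / \<kappa> * (H * t) powr (1 / p)"
proof -
  have "p > 0" using assms by simp
  have Lp: "(1 / \<kappa>) powr p = L"
    using assms by (simp add: powr_def)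
  have \<kappa>p: "(1 / L) powr (1 / p) = \<kappa>"
  proof -
    have "L powr (1 / p) = 1 / \<kappa>"
      unfolding Lp[symmetric] using \<open>p > 0\<close> assms(1) by (simp add: powr_powr)
    then show ?thesis using assms by (simp add: powr_divide)
  qed
  have pow: "(c ^ n) powr d = (c powr d) ^ n" if "c > 0" for c d :: real and n
    using that by (simp add: powr_power powr_realpow[symmetric] powr_powr mult.commute)
  have nonneg: "H * L * (H * t) powr p \<ge> 0" "H / \<kappa> * (H * t) powr (1 / p) \<ge> 0"
    using assms by auto
  show ?thesis
  proof (cases "y \<ge> 1")
    case True
    then obtain n where n: "2 ^ n \<le> y" "y \<le> 2 ^ Suc n" by (rule dyadic_bracket)
    \<comment> \<open>Decay of \<open>1 / t\<close> forces \<open>t\<close> to be large; the power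
      \<open>p\<close> turns this into a bound for \<open>L ^ n\<close>. The exponent
      \<open>Suc n\<close> in the growth of \<open>r\<close> accounts for the extra factor
      \<open>L\<close> in the coefficient.\<close>
    have "(1 / \<kappa>) ^ n \<le> H * t"
      using t_shrink[OF n(1)] assms by (simp add: field_simps)
    then have "((1 / \<kappa>) ^ n) powr p \<le> (H * t) powr p"
      using \<open>p > 0\<close> assms by (intro powr_mono2) auto
    then have "L ^ n \<le> (H * t) powr p"
      using assms Lp by (subst (asm) pow) auto
    then have "H * L * L ^ n \<le> H * L * (H * t) powr p"
      using assms by (intro mult_left_mono) auto
    then show ?thesis using r_grow[OF n(2)] nonneg by (simp add: mult_ac)
  next
    case False
    then have "1 / y \<ge> 1" using assms by simp
    then obtain n where n: "2 ^ n \<le> 1 / y" "1 / y \<le> 2 ^ Suc n" by (rule dyadic_bracket)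
    \<comment> \<open>Now growth of \<open>1 / t\<close> bounds \<open>t\<close> from below, and the
      power \<open>1 / p\<close> turns \<open>1 / L\<close> into \<open>\<kappa>\<close>. The
      division by \<open>\<kappa>\<close> in the coefficient compensates for the exponent
      \<open>Suc n\<close>.\<close>
    have "(1 / L) ^ Suc n \<le> H * t"
      using t_grow[OF n(2)] assms by (simp add: field_simps)
    then have "((1 / L) ^ Suc n) powr (1 / p) \<le> (H * t) powr (1 / p)"
      using \<open>p > 0\<close> assms by (intro powr_mono2) auto
    then have "\<kappa> ^ Suc n \<le> (H * t) powr (1 / p)"
      using assms \<kappa>p by (subst (asm) pow) auto
    then have "H / \<kappa> * \<kappa> ^ Suc n \<le> H / \<kappa> * (H * t) powr (1 / p)"
      using assms by (intro mult_left_mono) auto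
    moreover have "H / \<kappa> * \<kappa> ^ Suc n = H * \<kappa> ^ n" using assms by simp
    ultimately show ?thesis using r_shrink[OF n(1)] nonneg by linarith
  qed
qed

section \<open>Increments of the primitive of a doubling measure\<close>

text \<open>The doubling condition is expressed through the primitive, so that the estimates concern
  real functions only; strict monotonicity says that nondegenerate intervals have positive
  mass.\<close>

locale doubling_primitive =
  fixes u :: "real \<Rightarrow> real" and \<delta> :: real
  assumes \<delta>_pos: "\<delta> > 0"
    and u_strict: "strict_mono u"
    and u_left: "\<And>x h. h \<ge> 0 \<Longrightarrow> u x - u (x - h) \<le> (1 + \<delta>) * (u (x + h) - u x)"
    and u_right: "\<And>x h. h \<ge> 0 \<Longrightarrow> u (x + h) - u x \<le> (1 + \<delta>) * (u x - u (x - h))"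
begin

lemma u_mono: "mono u"
  using u_strict by (rule strict_mono_mono)

text \<open>Absolute values admit steps of either sign, so that later estimates treat both
  directions at once.\<close>

lemma u_reflect: "\<bar>u (x - h) - u x\<bar> \<le> (1 + \<delta>) * \<bar>u (x + h) - u x\<bar>"
proof (cases "h \<ge> 0")
  case True
  then have "u (x - h) \<le> u x" "u x \<le> u (x + h)" by (auto intro: monoD[OF u_mono])
  then show ?thesis using u_left[OF True, of x] by simp
next
  case False
  then have "u x \<le> u (x - h)" "u (x + h) \<le> u x" by (auto intro: monoD[OF u_mono])
  then show ?thesis using u_right[of "- h" x] False by simp
qed

lemma u_width: "\<bar>u (x + h) - u (x - h)\<bar> \<le> (2 + \<delta>) * \<bar>u (x + h) - u x\<bar>"
  using u_reflect[of x h] abs_triangle_ineq4[of "u (x + h) - u x" "u (x - h) - u x"]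
  by (simp add: algebra_simps)

text \<open>Reflection at the midpoint bounds the half next to \<open>x\<close> by
  \<open>1 + \<delta>\<close> times the other half, and the two halves add up to the whole.\<close>

lemma u_half: "\<bar>u (x + h / 2) - u x\<bar> \<le> (1 + \<delta>) / (2 + \<delta>) * \<bar>u (x + h) - u x\<bar>"
proof -
  have "\<bar>u x - u (x + h / 2)\<bar> \<le> (1 + \<delta>) * \<bar>u (x + h) - u (x + h / 2)\<bar>"
    using u_reflect[of "x + h / 2" "h / 2"] by (simp add: add.commute)
  moreover have "\<bar>u (x + h) - u x\<bar> = \<bar>u (x + h) - u (x + h / 2)\<bar> + \<bar>u x - u (x + h / 2)\<bar>"
  proof (cases "h \<ge> 0")
    case True
    then have "u x \<le> u (x + h / 2)" "u (x + h / 2) \<le> u (x + h)"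
      by (auto intro: monoD[OF u_mono])
    then show ?thesis by simp
  next
    case False
    then have "u x \<ge> u (x + h / 2)" "u (x + h / 2) \<ge> u (x + h)"
      by (auto intro: monoD[OF u_mono])
    then show ?thesis by simp
  qed
  ultimately have "(2 + \<delta>) * \<bar>u (x + h / 2) - u x\<bar> \<le> (1 + \<delta>) * \<bar>u (x + h) - u x\<bar>"
    by (simp add: algebra_simps abs_minus_commute)
  then show ?thesis using \<delta>_pos by (simp add: field_simps)
qed

lemma u_half_power: "\<bar>u (x + h / 2 ^ n) - u x\<bar> \<le> ((1 + \<delta>) / (2 + \<delta>)) ^ n * \<bar>u (x + h) - u x\<bar>"
proof (induction n)
  case (Suc n)
  have "\<bar>u (x + h / 2 ^ n / 2) - u x\<bar> \<le> (1 + \<delta>) / (2 + \<delta>) * \<bar>u (x + h / 2 ^ n) - u x\<bar>"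
    by (rule u_half)
  also have "\<dots> \<le> (1 + \<delta>) / (2 + \<delta>) * (((1 + \<delta>) / (2 + \<delta>)) ^ n * \<bar>u (x + h) - u x\<bar>)"
    using Suc \<delta>_pos by (intro mult_left_mono) auto
  finally show ?case by (simp add: mult_ac)
qed simp

text \<open>A jump would survive every halving of the step, whereas increments decay geometrically;
  monotonicity passes from the steps \<open>1 / 2 ^ n\<close> to all smaller ones.\<close>

lemma u_continuous: "continuous_on UNIV u"
proof -
  have "\<exists>d>0. \<forall>y. \<bar>y - x\<bar> < d \<longrightarrow> \<bar>u y - u x\<bar> < e" if "e > 0" for x e
  proof -
    define B where "B = max \<bar>u (x + 1) - u x\<bar> \<bar>u (x - 1) - u x\<bar> + 1"
    have "B > 0" by (auto simp: B_def)
    have "(1 + \<delta>) / (2 + \<delta>) < 1" using \<delta>_pos by simp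
    then obtain n where n: "((1 + \<delta>) / (2 + \<delta>)) ^ n < e / B"
      using real_arch_pow_inv[of "e / B"] \<open>e > 0\<close> \<open>B > 0\<close> by auto
    have bd: "\<bar>u (x + \<sigma> / 2 ^ n) - u x\<bar> < e" if "\<sigma> = 1 \<or> \<sigma> = -1" for \<sigma> :: real
    proof -
      have "\<bar>u (x + \<sigma> / 2 ^ n) - u x\<bar> \<le> ((1 + \<delta>) / (2 + \<delta>)) ^ n * \<bar>u (x + \<sigma>) - u x\<bar>"
        by (rule u_half_power)
      also have "\<dots> \<le> ((1 + \<delta>) / (2 + \<delta>)) ^ n * B"
        using that \<delta>_pos by (intro mult_left_mono) (auto simp: B_def)
      also have "\<dots> < e" using n \<open>B > 0\<close> by (simp add: field_simps)
      finally show ?thesis .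
    qed
    have "\<bar>u y - u x\<bar> < e" if "\<bar>y - x\<bar> < 1 / 2 ^ n" for y
    proof -
      have "x - 1 / 2 ^ n \<le> y" "y \<le> x + 1 / 2 ^ n" using that by auto
      then have "u (x - 1 / 2 ^ n) \<le> u y" "u y \<le> u (x + 1 / 2 ^ n)"
        by (auto intro: monoD[OF u_mono])
      then show ?thesis using bd[of 1] bd[of "-1"] by auto
    qed
    then show ?thesis by (intro exI[of _ "1 / 2 ^ n"]) auto
  qed
  then show ?thesis by (auto simp: continuous_on_iff dist_real_def)
qed

text \<open>Contraction under halving, read backwards, is geometric growth under doubling, so
  \<open>u\<close> is unbounded in both directions.\<close>

lemma u_surj: "range u = UNIV"
proof -
  have big: "\<exists>h. \<bar>h\<bar> = 2 ^ n \<and> sgn h = \<sigma> \<and> ((2 + \<delta>) / (1 + \<delta>)) ^ n * \<bar>u \<sigma> - u 0\<bar> \<le> \<bar>u h - u 0\<bar>"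
    if "\<sigma> = 1 \<or> \<sigma> = -1" for \<sigma> :: real and n
  proof (intro exI[of _ "\<sigma> * 2 ^ n"] conjI)
    have "\<bar>u \<sigma> - u 0\<bar> \<le> ((1 + \<delta>) / (2 + \<delta>)) ^ n * \<bar>u (\<sigma> * 2 ^ n) - u 0\<bar>"
      using u_half_power[of 0 "\<sigma> * 2 ^ n" n] by simp
    then show "((2 + \<delta>) / (1 + \<delta>)) ^ n * \<bar>u \<sigma> - u 0\<bar> \<le> \<bar>u (\<sigma> * 2 ^ n) - u 0\<bar>"
      using \<delta>_pos by (simp add: field_simps)
  qed (use that in \<open>auto simp: abs_mult sgn_mult\<close>)
  have unb: "\<exists>h. sgn h = \<sigma> \<and> B \<le> \<bar>u h - u 0\<bar>" if \<sigma>: "\<sigma> = 1 \<or> \<sigma> = -1" for \<sigma> B :: real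
  proof -
    have pos: "\<bar>u \<sigma> - u 0\<bar> > 0"
      using \<sigma> u_strict by (auto simp: strict_mono_eq)
    have "(2 + \<delta>) / (1 + \<delta>) > 1" using \<delta>_pos by simp
    then obtain n where "B / \<bar>u \<sigma> - u 0\<bar> < ((2 + \<delta>) / (1 + \<delta>)) ^ n"
      using real_arch_pow by blast
    then have "B \<le> ((2 + \<delta>) / (1 + \<delta>)) ^ n * \<bar>u \<sigma> - u 0\<bar>"
      using pos by (simp add: field_simps)
    with big[OF \<sigma>, of n] show ?thesis by force
  qed
  have "y \<in> range u" for y
  proof -
    obtain p where p: "sgn p = 1" "\<bar>y - u 0\<bar> \<le> \<bar>u p - u 0\<bar>" using unb by blast
    obtain q where q: "sgn q = -1" "\<bar>y - u 0\<bar> \<le> \<bar>u q - u 0\<bar>" using unb by blast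
    have "q \<le> 0" "0 \<le> p" using p q by (auto simp: sgn_if split: if_splits)
    then have "u q \<le> u 0" "u 0 \<le> u p" by (auto intro: monoD[OF u_mono])
    with p q have "u q \<le> y" "y \<le> u p" by auto
    moreover have "q \<le> p" using \<open>q \<le> 0\<close> \<open>0 \<le> p\<close> by simp
    moreover have "continuous_on {q..p} u" using u_continuous continuous_on_subset by blast
    ultimately show ?thesis using IVT'[of u q y p] by blast
  qed
  then show ?thesis by auto
qed

section \<open>Growth and decay of increments of Zygmund curves\<close>

text \<open>Domination by \<open>g\<close> is automatic both for \<open>g = u\<close> and for the curve with real part \<open>u\<close>,
  so that all estimates below serve both.\<close>

definition zygmund_curve :: "(real \<Rightarrow> 'a::real_normed_vector) \<Rightarrow> real \<Rightarrow> bool" where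
  "zygmund_curve g A \<longleftrightarrow> continuous_on UNIV g \<and> A \<ge> 0 \<and>
     (\<forall>x y. \<bar>u y - u x\<bar> \<le> norm (g y - g x)) \<and>
     (\<forall>x. \<forall>h\<ge>0. norm (g (x + h) - 2 *\<^sub>R g x + g (x - h)) \<le> A * (u (x + h) - u (x - h)))"

lemma zygmund_curveD:
  assumes "zygmund_curve g A"
  shows "continuous_on UNIV g" "A \<ge> 0" "\<bar>u y - u x\<bar> \<le> norm (g y - g x)"
    "norm (g (x + h) - 2 *\<^sub>R g x + g (x - h)) \<le> A * \<bar>u (x + h) - u (x - h)\<bar>"
proof -
  show "norm (g (x + h) - 2 *\<^sub>R g x + g (x - h)) \<le> A * \<bar>u (x + h) - u (x - h)\<bar>"
  proof (cases "h \<ge> 0")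
    case True
    then have "u (x - h) \<le> u (x + h)" by (intro monoD[OF u_mono]) auto
    then show ?thesis using assms True by (auto simp: zygmund_curve_def)
  next
    case False
    then have "u (x + h) \<le> u (x - h)" by (intro monoD[OF u_mono]) auto
    moreover have "norm (g (x + - h) - 2 *\<^sub>R g x + g (x - - h)) \<le> A * (u (x + - h) - u (x - - h))"
      using assms False unfolding zygmund_curve_def by (metis le_minus_iff linear minus_zero)
    moreover have "g (x + - h) - 2 *\<^sub>R g x + g (x - - h) = g (x + h) - 2 *\<^sub>R g x + g (x - h)"
      by (simp add: algebra_simps)
    ultimately show ?thesis by (simp only:) simp
  qed
qed (use assms in \<open>auto simp: zygmund_curve_def\<close>)

lemma zygmund_curve_increment_pos:
  assumes "zygmund_curve g A" "h \<noteq> 0"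
  shows "\<bar>u (x + h) - u x\<bar> > 0" "norm (g (x + h) - g x) > 0"
proof -
  show "\<bar>u (x + h) - u x\<bar> > 0" using assms u_strict by (simp add: strict_mono_eq)
  then show "norm (g (x + h) - g x) > 0"
    using zygmund_curveD(3)[OF assms(1), where x = x and y = "x + h"] by (rule less_le_trans)
qed

text \<open>If \<open>k\<close> and \<open>h\<close> point the same way this is the interpolation
  estimate. Otherwise \<open>k\<close> is compared with the chord over \<open>- h\<close>, which is
  exchanged for the chord over \<open>h\<close> at the cost of one second difference; the costs
  \<open>1 + \<delta>\<close> and \<open>2 + \<delta>\<close> add up to
  \<open>3 + 2 * \<delta>\<close>.\<close>

lemma zygmund_curve_chord:
  assumes g: "zygmund_curve g A" and "h \<noteq> 0" "\<bar>k\<bar> \<le> \<bar>h\<bar>"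
  shows "norm (g (x + k) - g x - (k / h) *\<^sub>R (g (x + h) - g x))
    \<le> A * (3 + 2 * \<delta>) * \<bar>u (x + h) - u x\<bar>"
proof -
  have zyg: "norm (g (x + h) - 2 *\<^sub>R g x + g (x - h)) \<le> A * (u (x + h) - u (x - h))"
    if "h \<ge> 0" for x h
    using g that by (auto simp: zygmund_curve_def)
  have A: "A \<ge> 0" using zygmund_curveD[OF g] by simp
  have same: "norm (g (x + k) - g x - (k / h) *\<^sub>R (g (x + h) - g x)) \<le> A * \<bar>u (x + h) - u x\<bar>"
    if "h \<noteq> 0" "0 \<le> k / h" "\<bar>k\<bar> \<le> \<bar>h\<bar>" for h k
  proof (cases "h > 0")
    case True
    then have "norm (g (x + k) - g x - ((x + k - x) / (x + h - x)) *\<^sub>R (g (x + h) - g x))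
        \<le> A * (u (x + h) - u x)"
      using that
      by (intro zygmund_chord[OF u_mono zygmund_curveD(1)[OF g] A zyg]) (auto simp: zero_le_divide_iff)
    moreover have "u x \<le> u (x + h)" using True by (intro monoD[OF u_mono]) auto
    ultimately show ?thesis by simp
  next
    case False
    then have h: "h < 0" and k: "k \<le> 0" using that by (auto simp: zero_le_divide_iff)
    \<comment> \<open>The interval now starts at \<open>x + h\<close>, so the weight is
      \<open>1 - k / h\<close>; the deviation from the chord is still the same vector.\<close>
    have "norm (g (x + k) - g (x + h) - ((x + k - (x + h)) / (x - (x + h))) *\<^sub>R (g x - g (x + h)))
        \<le> A * (u x - u (x + h))"
      using that h k
      by (intro zygmund_chord[OF u_mono zygmund_curveD(1)[OF g] A zyg]) auto
    moreover have "(x + k - (x + h)) / (x - (x + h)) = 1 - k / h" using h by (simp add: field_simps)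
    moreover have "u (x + h) \<le> u x" using h by (intro monoD[OF u_mono]) auto
    ultimately show ?thesis by (simp add: algebra_simps)
  qed
  show ?thesis
  proof (cases "0 \<le> k / h")
    case True
    have "A * \<bar>u (x + h) - u x\<bar> * 1 \<le> A * \<bar>u (x + h) - u x\<bar> * (3 + 2 * \<delta>)"
      using A \<delta>_pos by (intro mult_left_mono) auto
    then show ?thesis using same[of h k] True assms by (simp add: mult_ac)
  next
    case False
    let ?U = "\<bar>u (x + h) - u x\<bar>"
    have 1: "norm (g (x + k) - g x - (k / (- h)) *\<^sub>R (g (x + - h) - g x)) \<le> A * ((1 + \<delta>) * ?U)"
      using same[of "- h" k] False assms mult_left_mono[OF u_reflect[of x h] A] by simp
    have 2: "norm (g (x + h) - 2 *\<^sub>R g x + g (x - h)) \<le> A * ((2 + \<delta>) * ?U)"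
      using zygmund_curveD(4)[OF g, of x h] mult_left_mono[OF u_width[of x h] A] by simp
    have "norm ((k / h) *\<^sub>R (g (x + h) - 2 *\<^sub>R g x + g (x - h)))
        \<le> 1 * norm (g (x + h) - 2 *\<^sub>R g x + g (x - h))"
      unfolding norm_scaleR using assms by (intro mult_right_mono) auto
    then have 3: "norm ((k / h) *\<^sub>R (g (x + h) - 2 *\<^sub>R g x + g (x - h))) \<le> A * ((2 + \<delta>) * ?U)"
      using 2 by linarith
    have "g (x + k) - g x - (k / h) *\<^sub>R (g (x + h) - g x)
      = (g (x + k) - g x - (k / (- h)) *\<^sub>R (g (x + - h) - g x))
        - (k / h) *\<^sub>R (g (x + h) - 2 *\<^sub>R g x + g (x - h))"
      by (simp add: algebra_simps scaleR_2)
    then have "norm (g (x + k) - g x - (k / h) *\<^sub>R (g (x + h) - g x))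
      \<le> A * ((1 + \<delta>) * ?U) + A * ((2 + \<delta>) * ?U)"
      using norm_triangle_le_diff[OF add_mono[OF 1 3]] by (simp only:)
    then show ?thesis by (simp add: algebra_simps)
  qed
qed

text \<open>Since increments of \<open>u\<close> are dominated by those of \<open>g\<close>, the
  chord error becomes a relative one: the ratio of increments of \<open>g\<close> differs from the
  ratio of the steps by at most a fixed constant.\<close>

lemma zygmund_curve_ratio:
  assumes g: "zygmund_curve g A" and "h \<noteq> 0" "\<bar>k\<bar> \<le> \<bar>h\<bar>"
  shows "\<bar>norm (g (x + k) - g x) - \<bar>k\<bar> / \<bar>h\<bar> * norm (g (x + h) - g x)\<bar>
    \<le> A * (3 + 2 * \<delta>) * norm (g (x + h) - g x)"
proof -
  have "\<bar>norm (g (x + k) - g x) - \<bar>k\<bar> / \<bar>h\<bar> * norm (g (x + h) - g x)\<bar>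
    \<le> norm (g (x + k) - g x - (k / h) *\<^sub>R (g (x + h) - g x))"
    using norm_triangle_ineq3[of "g (x + k) - g x" "(k / h) *\<^sub>R (g (x + h) - g x)"] by simp
  also have "\<dots> \<le> A * (3 + 2 * \<delta>) * \<bar>u (x + h) - u x\<bar>"
    using assms by (rule zygmund_curve_chord)
  also have "\<dots> \<le> A * (3 + 2 * \<delta>) * norm (g (x + h) - g x)"
    using zygmund_curveD[OF g] \<delta>_pos by (intro mult_left_mono) auto
  finally show ?thesis .
qed

lemma zygmund_curve_weak:
  assumes g: "zygmund_curve g A" and "h \<noteq> 0" "\<bar>k\<bar> \<le> \<bar>h\<bar>"
  shows "norm (g (x + k) - g x) \<le> (1 + A * (3 + 2 * \<delta>)) * norm (g (x + h) - g x)"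
proof -
  have "\<bar>k\<bar> / \<bar>h\<bar> * norm (g (x + h) - g x) \<le> 1 * norm (g (x + h) - g x)"
    using assms by (intro mult_right_mono) auto
  then show ?thesis using zygmund_curve_ratio[OF assms, of x] by (simp add: algebra_simps)
qed

text \<open>The second difference at \<open>x + h\<close> compares the increment over
  \<open>2 * h\<close> with twice that over \<open>h\<close>; doubling of \<open>u\<close> and
  domination by \<open>g\<close> control its size.\<close>

lemma zygmund_curve_double:
  assumes g: "zygmund_curve g A"
  shows "norm (g (x + 2 * h) - g x) \<le> (2 + A * (2 + \<delta>)) * norm (g (x + h) - g x)"
proof -
  have "\<bar>u (x + 2 * h) - u x\<bar> \<le> (2 + \<delta>) * \<bar>u (x + h) - u x\<bar>"
    using u_width[of "x + h" "- h"] by (simp add: abs_minus_commute add.assoc)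
  also have "\<dots> \<le> (2 + \<delta>) * norm (g (x + h) - g x)"
    using zygmund_curveD[OF g] \<delta>_pos by (intro mult_left_mono) auto
  finally have U: "A * \<bar>u (x + 2 * h) - u x\<bar> \<le> A * ((2 + \<delta>) * norm (g (x + h) - g x))"
    using zygmund_curveD[OF g] by (intro mult_left_mono) auto
  have eq: "x + 2 * h = x + h + h" by simp
  have "g (x + 2 * h) - g x
      = (g (x + h + h) - 2 *\<^sub>R g (x + h) + g (x + h - h)) + 2 *\<^sub>R (g (x + h) - g x)"
    unfolding eq by (simp add: scaleR_2)
  then have "norm (g (x + 2 * h) - g x)
      \<le> norm (g (x + h + h) - 2 *\<^sub>R g (x + h) + g (x + h - h)) + 2 * norm (g (x + h) - g x)"
    by (metis norm_triangle_ineq norm_scaleR abs_numeral)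
  also have "\<dots> \<le> A * \<bar>u (x + 2 * h) - u x\<bar> + 2 * norm (g (x + h) - g x)"
    using zygmund_curveD(4)[OF g, of "x + h" h] unfolding eq by simp
  finally show ?thesis using U by (simp add: algebra_simps)
qed

lemma zygmund_curve_grow:
  assumes g: "zygmund_curve g A" and "h \<noteq> 0" "\<bar>k\<bar> \<le> 2 ^ n * \<bar>h\<bar>"
  shows "norm (g (x + k) - g x)
    \<le> (1 + A * (3 + 2 * \<delta>)) * (2 + A * (2 + \<delta>)) ^ n * norm (g (x + h) - g x)"
proof -
  have A: "A \<ge> 0" using zygmund_curveD[OF g] by simp
  have pow: "norm (g (x + 2 ^ n * h) - g x) \<le> (2 + A * (2 + \<delta>)) ^ n * norm (g (x + h) - g x)"
  proof (induction n)
    case (Suc n)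
    have "norm (g (x + 2 * (2 ^ n * h)) - g x) \<le> (2 + A * (2 + \<delta>)) * norm (g (x + 2 ^ n * h) - g x)"
      by (rule zygmund_curve_double[OF g])
    also have "\<dots> \<le> (2 + A * (2 + \<delta>)) * ((2 + A * (2 + \<delta>)) ^ n * norm (g (x + h) - g x))"
      using A \<delta>_pos Suc by (intro mult_left_mono) auto
    finally show ?case by (simp add: mult_ac)
  qed simp
  have "norm (g (x + k) - g x) \<le> (1 + A * (3 + 2 * \<delta>)) * norm (g (x + 2 ^ n * h) - g x)"
    using assms by (intro zygmund_curve_weak[OF g]) (auto simp: abs_mult)
  also have "\<dots> \<le> (1 + A * (3 + 2 * \<delta>)) * ((2 + A * (2 + \<delta>)) ^ n * norm (g (x + h) - g x))"
    using A \<delta>_pos pow by (intro mult_left_mono) auto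
  finally show ?thesis by (simp add: mult_ac)
qed

text \<open>The increments of \<open>g\<close> alone need not contract when the step is halved; those of the
  sum \<open>|g| + A (2 + \<delta>) |u|\<close> do.\<close>

lemma zygmund_curve_shrink:
  assumes g: "zygmund_curve g A" and "h \<noteq> 0" "2 ^ n * \<bar>k\<bar> \<le> \<bar>h\<bar>"
  shows "norm (g (x + k) - g x)
    \<le> (1 + A * (3 + 2 * \<delta>)) * (1 + A * (2 + \<delta>)) * ((3 + 2 * \<delta>) / (4 + 2 * \<delta>)) ^ n
       * norm (g (x + h) - g x)"
proof -
  have A: "A \<ge> 0" using zygmund_curveD[OF g] by simp
  \<comment> \<open>The factor \<open>?\<kappa>\<close> is the mean of 1 and the contraction factor
    \<open>(1 + \<delta>) / (2 + \<delta>)\<close> of \<open>u\<close>. This weight solves \<open>A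
    / 2 + c * ((1 + \<delta>) / (2 + \<delta>)) = ?\<kappa> * c\<close>, so the error in halving
    \<open>g\<close> is absorbed by the contraction of \<open>u\<close>.\<close>
  define c where "c = A * (2 + \<delta>)"
  have c: "c \<ge> 0" using A \<delta>_pos by (simp add: c_def)
  let ?\<kappa> = "(3 + 2 * \<delta>) / (4 + 2 * \<delta>)"
  define W where "W h = norm (g (x + h) - g x) + c * \<bar>u (x + h) - u x\<bar>" for h
  have half: "W (h / 2) \<le> ?\<kappa> * W h" for h
  proof -
    have "2 *\<^sub>R (g (x + h / 2) - g x)
      = (g (x + h) - g x) - (g (x + h / 2 + h / 2) - 2 *\<^sub>R g (x + h / 2) + g (x + h / 2 - h / 2))"
      by (simp add: algebra_simps scaleR_2)
    then have "2 * norm (g (x + h / 2) - g x) \<le> norm (g (x + h) - g x)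
       + norm (g (x + h / 2 + h / 2) - 2 *\<^sub>R g (x + h / 2) + g (x + h / 2 - h / 2))"
      by (metis norm_triangle_ineq4 norm_scaleR abs_numeral)
    also have "\<dots> \<le> norm (g (x + h) - g x) + A * \<bar>u (x + h) - u x\<bar>"
      using zygmund_curveD(4)[OF g, of "x + h / 2" "h / 2"] by (simp add: add.commute)
    finally have 1: "norm (g (x + h / 2) - g x)
      \<le> 1 / 2 * norm (g (x + h) - g x) + A / 2 * \<bar>u (x + h) - u x\<bar>" by simp
    have 2: "c * \<bar>u (x + h / 2) - u x\<bar> \<le> c * ((1 + \<delta>) / (2 + \<delta>) * \<bar>u (x + h) - u x\<bar>)"
      using c u_half by (intro mult_left_mono)
    have 3: "1 / 2 * norm (g (x + h) - g x) \<le> ?\<kappa> * norm (g (x + h) - g x)"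
      using \<delta>_pos by (intro mult_right_mono) (auto simp: field_simps)
    have "A / 2 + c * ((1 + \<delta>) / (2 + \<delta>)) = ?\<kappa> * c"
      using \<delta>_pos unfolding c_def by (simp add: divide_simps) (simp add: algebra_simps)
    then have "A / 2 * \<bar>u (x + h) - u x\<bar> + c * ((1 + \<delta>) / (2 + \<delta>) * \<bar>u (x + h) - u x\<bar>)
       = ?\<kappa> * (c * \<bar>u (x + h) - u x\<bar>)"
      by (metis distrib_right mult.assoc)
    then show ?thesis using 1 2 3 unfolding W_def distrib_left by linarith
  qed
  have pow: "W (h / 2 ^ n) \<le> ?\<kappa> ^ n * W h"
  proof (induction n)
    case (Suc n)
    have "W (h / 2 ^ n / 2) \<le> ?\<kappa> * W (h / 2 ^ n)" by (rule half)
    also have "\<dots> \<le> ?\<kappa> * (?\<kappa> ^ n * W h)" using Suc \<delta>_pos by (intro mult_left_mono) auto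
    finally show ?case by (simp add: mult_ac)
  qed simp
  have "c * \<bar>u (x + h) - u x\<bar> \<le> c * norm (g (x + h) - g x)"
    using c zygmund_curveD[OF g] by (intro mult_left_mono) auto
  then have W: "W h \<le> (1 + c) * norm (g (x + h) - g x)" by (simp add: W_def algebra_simps)
  have "norm (g (x + k) - g x) \<le> (1 + A * (3 + 2 * \<delta>)) * norm (g (x + h / 2 ^ n) - g x)"
    using assms by (intro zygmund_curve_weak[OF g]) (auto simp: field_simps)
  also have "\<dots> \<le> (1 + A * (3 + 2 * \<delta>)) * W (h / 2 ^ n)"
    using A \<delta>_pos c by (intro mult_left_mono) (auto simp: W_def)
  also have "\<dots> \<le> (1 + A * (3 + 2 * \<delta>)) * (?\<kappa> ^ n * ((1 + c) * norm (g (x + h) - g x)))"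
    using A \<delta>_pos by (intro mult_left_mono order.trans[OF pow] W) auto
  finally show ?thesis by (simp add: c_def mult_ac)
qed

section \<open>Comparison of increment ratios of two curves\<close>

text \<open>Increments of \<open>u\<close> and of \<open>g\<close> obey growth and decay bounds with
  common constants independent of the base point, so the dyadic comparison applies with
  \<open>y\<close> the ratio of the steps and yields one gauge for all \<open>x\<close>.\<close>

lemma zygmund_curve_qs:
  assumes u: "zygmund_curve u A" and g: "zygmund_curve g A"
  obtains \<eta> where "halfline_gauge \<eta>"
    "\<And>x h k. h \<noteq> 0 \<Longrightarrow> k \<noteq> 0 \<Longrightarrow>
      \<bar>u (x + k) - u x\<bar> \<le> \<eta> (norm (g (x + k) - g x) / norm (g (x + h) - g x)) * \<bar>u (x + h) - u x\<bar>"
proof -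
  define H where "H = (1 + A * (3 + 2 * \<delta>)) * (1 + A * (2 + \<delta>))"
  define L where "L = 2 + A * (2 + \<delta>)"
  define \<kappa> where "\<kappa> = (3 + 2 * \<delta>) / (4 + 2 * \<delta>)"
  define p where "p = ln L / ln (1 / \<kappa>)"
  have A: "A \<ge> 0" using zygmund_curveD[OF g] by simp
  then have "L > 1" "0 < \<kappa>" "\<kappa> < 1" using \<delta>_pos by (auto simp: L_def \<kappa>_def add_pos_nonneg)
  have weak: "1 + A * (3 + 2 * \<delta>) \<ge> 1" "1 + A * (2 + \<delta>) \<ge> 1" using A \<delta>_pos by auto
  then have "H \<ge> 1" "1 + A * (3 + 2 * \<delta>) \<le> H"
    unfolding H_def using mult_mono[OF weak] mult_left_mono[OF weak(2), of "1 + A * (3 + 2 * \<delta>)"] by auto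
  have grow: "(1 + A * (3 + 2 * \<delta>)) * L ^ n * c \<le> H * L ^ n * c" if "c \<ge> 0" for c n
    using \<open>1 + A * (3 + 2 * \<delta>) \<le> H\<close> \<open>L > 1\<close> that by (intro mult_right_mono) auto
  have "p > 0" unfolding p_def using \<open>L > 1\<close> \<open>0 < \<kappa>\<close> \<open>\<kappa> < 1\<close> by simp
  show thesis
  proof (rule that)
    show "halfline_gauge (\<lambda>t. H * L * (H * t) powr p + H / \<kappa> * (H * t) powr (1 / p))"
      using \<open>H \<ge> 1\<close> \<open>L > 1\<close> \<open>0 < \<kappa>\<close> \<open>p > 0\<close> by (intro halfline_gauge_powr) auto
    fix x h k :: real assume "h \<noteq> 0" "k \<noteq> 0"
    define P where "P h = \<bar>u (x + h) - u x\<bar>" for h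
    define Q where "Q h = norm (g (x + h) - g x)" for h
    have pos: "P h > 0" "Q h > 0" if "h \<noteq> 0" for h
      using zygmund_curve_increment_pos[OF g that] by (auto simp: P_def Q_def)
    have P_grow: "P k \<le> H * L ^ n * P h" if "h \<noteq> 0" "\<bar>k\<bar> \<le> 2 ^ n * \<bar>h\<bar>" for h k n
      using zygmund_curve_grow[OF u that, of x] grow[of "P h" n] by (simp add: P_def L_def)
    have Q_grow: "Q k \<le> H * L ^ n * Q h" if "h \<noteq> 0" "\<bar>k\<bar> \<le> 2 ^ n * \<bar>h\<bar>" for h k n
      using zygmund_curve_grow[OF g that, of x] grow[of "Q h" n] by (simp add: Q_def L_def)
    have P_shrink: "P k \<le> H * \<kappa> ^ n * P h" if "h \<noteq> 0" "2 ^ n * \<bar>k\<bar> \<le> \<bar>h\<bar>" for h k n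
      using zygmund_curve_shrink[OF u that, of x] by (simp add: P_def H_def \<kappa>_def)
    have Q_shrink: "Q k \<le> H * \<kappa> ^ n * Q h" if "h \<noteq> 0" "2 ^ n * \<bar>k\<bar> \<le> \<bar>h\<bar>" for h k n
      using zygmund_curve_shrink[OF g that, of x] by (simp add: Q_def H_def \<kappa>_def)
    have "P k / P h \<le> H * L * (H * (Q k / Q h)) powr p + H / \<kappa> * (H * (Q k / Q h)) powr (1 / p)"
    proof (rule dyadic_powr_bound[where y = "\<bar>k\<bar> / \<bar>h\<bar>"])
      show "P k / P h \<le> H * L ^ n" if "\<bar>k\<bar> / \<bar>h\<bar> \<le> 2 ^ n" for n
        using P_grow[of h k n] that pos \<open>h \<noteq> 0\<close> by (simp add: pos_divide_le_eq)
      \<comment> \<open>The reciprocal is \<open>Q h / Q k\<close>, so \<open>h\<close> and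
        \<open>k\<close> exchange their roles here.\<close>
      show "1 / (Q k / Q h) \<le> H * \<kappa> ^ n" if "2 ^ n \<le> \<bar>k\<bar> / \<bar>h\<bar>" for n
        using Q_shrink[of k n h] that pos \<open>h \<noteq> 0\<close> \<open>k \<noteq> 0\<close>
        by (simp add: pos_divide_le_eq pos_le_divide_eq)
      show "P k / P h \<le> H * \<kappa> ^ n" if "2 ^ n \<le> 1 / (\<bar>k\<bar> / \<bar>h\<bar>)" for n
        using P_shrink[of h n k] that pos \<open>h \<noteq> 0\<close> \<open>k \<noteq> 0\<close>
        by (simp add: pos_divide_le_eq pos_le_divide_eq)
      show "1 / (Q k / Q h) \<le> H * L ^ n" if "1 / (\<bar>k\<bar> / \<bar>h\<bar>) \<le> 2 ^ n" for n
        using Q_grow[of k h n] that pos \<open>h \<noteq> 0\<close> \<open>k \<noteq> 0\<close>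
        by (simp add: pos_divide_le_eq pos_le_divide_eq)
    qed (use pos \<open>h \<noteq> 0\<close> \<open>k \<noteq> 0\<close> \<open>H \<ge> 1\<close> \<open>L > 1\<close> \<open>0 < \<kappa>\<close> \<open>\<kappa> < 1\<close> in \<open>auto simp: p_def\<close>)
    then show "\<bar>u (x + k) - u x\<bar> \<le> (H * L * (H * (norm (g (x + k) - g x) / norm (g (x + h) - g x))) powr p
       + H / \<kappa> * (H * (norm (g (x + k) - g x) / norm (g (x + h) - g x))) powr (1 / p)) * \<bar>u (x + h) - u x\<bar>"
      using pos \<open>h \<noteq> 0\<close> unfolding P_def Q_def by (simp add: pos_divide_le_eq)
  qed
qed

text \<open>With \<open>e = A * (3 + 2 * \<delta>)\<close>, both increment ratios are within
  \<open>e\<close> of the step ratio if \<open>k\<close> is the shorter step. If \<open>k\<close> is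
  the longer one, this holds for the reciprocals, and inverting costs a factor of order
  \<open>t * t\<close>, at most \<open>4 / s ^ 2\<close>; hence the cubic smallness
  condition.\<close>

lemma zygmund_curve_near:
  fixes s :: real
  assumes u: "zygmund_curve u A" and g: "zygmund_curve g A" and "s > 0"
    and e: "A * (3 + 2 * \<delta>) \<le> s / 8" "A * (3 + 2 * \<delta>) \<le> s ^ 3 / 16"
    and "h \<noteq> 0" "k \<noteq> 0" and le: "norm (g (x + k) - g x) \<le> 2 / s * norm (g (x + h) - g x)"
  shows "\<bar>u (x + k) - u x\<bar>
    \<le> (norm (g (x + k) - g x) / norm (g (x + h) - g x) + s) * \<bar>u (x + h) - u x\<bar>"
proof -
  define P where "P h = \<bar>u (x + h) - u x\<bar>" for h
  define Q where "Q h = norm (g (x + h) - g x)" for h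
  define e where "e = A * (3 + 2 * \<delta>)"
  have "e \<ge> 0" using zygmund_curveD(2)[OF g] \<delta>_pos by (simp add: e_def)
  have pos: "P h > 0" "Q h > 0" if "h \<noteq> 0" for h
    using zygmund_curve_increment_pos[OF g that] by (auto simp: P_def Q_def)
  define t where "t = Q k / Q h"
  have t: "0 < t" "t \<le> 2 / s"
    using le pos assms unfolding t_def Q_def by (auto simp: pos_divide_le_eq)
  have P: "\<bar>P k - \<bar>k\<bar> / \<bar>h\<bar> * P h\<bar> \<le> e * P h"
    and Q: "\<bar>Q k - \<bar>k\<bar> / \<bar>h\<bar> * Q h\<bar> \<le> e * Q h" if "h \<noteq> 0" "\<bar>k\<bar> \<le> \<bar>h\<bar>" for h k
    using zygmund_curve_ratio[OF u that, of x] zygmund_curve_ratio[OF g that, of x]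
    by (simp_all add: P_def Q_def e_def)
  have "P k \<le> (t + s) * P h"
  proof (cases "\<bar>k\<bar> \<le> \<bar>h\<bar>")
    case True
    have "\<bar>k\<bar> / \<bar>h\<bar> * Q h \<le> (t + e) * Q h"
      using Q[OF \<open>h \<noteq> 0\<close> True] pos[OF \<open>h \<noteq> 0\<close>] by (simp add: t_def distrib_right)
    then have "\<bar>k\<bar> / \<bar>h\<bar> \<le> t + e"
      using pos[OF \<open>h \<noteq> 0\<close>] by (meson mult_le_cancel_right_pos)
    then have "\<bar>k\<bar> / \<bar>h\<bar> * P h \<le> (t + e) * P h"
      using pos[OF \<open>h \<noteq> 0\<close>] by (intro mult_right_mono) auto
    then have "P k \<le> (t + 2 * e) * P h"
      using P[OF \<open>h \<noteq> 0\<close> True] by (simp add: distrib_right)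
    also have "\<dots> \<le> (t + s) * P h"
      using e \<open>s > 0\<close> pos[OF \<open>h \<noteq> 0\<close>] unfolding e_def[symmetric] by (intro mult_right_mono) auto
    finally show ?thesis .
  next
    case False
    then have hk: "\<bar>h\<bar> \<le> \<bar>k\<bar>" by simp
    have "1 / t * Q k = Q h" using pos[OF \<open>h \<noteq> 0\<close>] pos[OF \<open>k \<noteq> 0\<close>] by (simp add: t_def)
    then have "1 / t * Q k \<le> (\<bar>h\<bar> / \<bar>k\<bar> + e) * Q k"
      using Q[OF \<open>k \<noteq> 0\<close> hk] by (simp add: distrib_right)
    then have "1 / t \<le> \<bar>h\<bar> / \<bar>k\<bar> + e"
      using pos[OF \<open>k \<noteq> 0\<close>] by (meson mult_le_cancel_right_pos)
    then have "(1 / t - e) * P k \<le> \<bar>h\<bar> / \<bar>k\<bar> * P k"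
      using pos[OF \<open>k \<noteq> 0\<close>] by (intro mult_right_mono) auto
    then have Ph: "(1 / t - 2 * e) * P k \<le> P h"
      using P[OF \<open>k \<noteq> 0\<close> hk] by (simp add: left_diff_distrib)
    \<comment> \<open>Multiplied out, \<open>1 \<le> (t + s) * (1 / t - 2 * e)\<close> says that
      these two error terms together are at most \<open>s\<close>; each smallness condition makes
      one of them at most \<open>s / 2\<close>.\<close>
    have "2 * e * t * t \<le> 2 * (s ^ 3 / 16) * (2 / s) * (2 / s)"
      using e t \<open>e \<ge> 0\<close> \<open>s > 0\<close> unfolding e_def[symmetric] by (intro mult_mono) auto
    moreover have "2 * (s ^ 3 / 16) * (2 / s) * (2 / s) = s / 2"
      using \<open>s > 0\<close> by (simp add: field_simps power3_eq_cube)
    moreover have "2 * e * t * s \<le> 2 * (s / 8) * (2 / s) * s"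
      using e t \<open>e \<ge> 0\<close> \<open>s > 0\<close> unfolding e_def[symmetric] by (intro mult_mono) auto
    moreover have "2 * (s / 8) * (2 / s) * s = s / 2" using \<open>s > 0\<close> by simp
    ultimately have "2 * e * t * t + 2 * e * t * s \<le> s" by linarith
    then have "1 \<le> (t + s) * (1 / t - 2 * e)" using t by (simp add: field_simps)
    then have "1 * P k \<le> (t + s) * (1 / t - 2 * e) * P k"
      using pos[OF \<open>k \<noteq> 0\<close>] by (intro mult_right_mono) auto
    also have "\<dots> \<le> (t + s) * P h"
      unfolding mult.assoc using Ph t \<open>s > 0\<close> by (intro mult_left_mono) auto
    finally show ?thesis by simp
  qed
  then show ?thesis by (simp add: P_def Q_def t_def)
qed

section \<open>The graph and its projection\<close>

text \<open>The second difference of \<open>u\<close> is the difference of the masses of two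
  adjacent intervals, which doubling bounds by \<open>\<delta>\<close> times the smaller
  mass.\<close>

lemma zygmund_curve_self: "zygmund_curve u \<delta>"
  unfolding zygmund_curve_def
proof (intro conjI allI impI)
  fix x h :: real assume h: "h \<ge> 0"
  define p q where "p = u (x + h) - u x" and "q = u x - u (x - h)"
  have "p \<ge> 0" "q \<ge> 0" using h by (auto simp: p_def q_def intro: monoD[OF u_mono])
  moreover have "q \<le> (1 + \<delta>) * p" "p \<le> (1 + \<delta>) * q"
    using u_left[OF h] u_right[OF h] by (auto simp: p_def q_def)
  moreover have "0 \<le> \<delta> * p" "0 \<le> \<delta> * q" using \<delta>_pos \<open>p \<ge> 0\<close> \<open>q \<ge> 0\<close> by auto
  ultimately have "\<bar>p - q\<bar> \<le> \<delta> * (p + q)" by (simp add: algebra_simps)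
  then show "norm (u (x + h) - 2 *\<^sub>R u x + u (x - h)) \<le> \<delta> * (u (x + h) - u (x - h))"
    by (simp add: p_def q_def)
qed (use u_continuous \<delta>_pos in auto)

lemma zygmund_curve_weaken:
  assumes "zygmund_curve g A" "A \<le> B"
  shows "zygmund_curve g B"
proof -
  have "A * (u (x + h) - u (x - h)) \<le> B * (u (x + h) - u (x - h))" if "h \<ge> 0" for x h
    using that assms by (intro mult_right_mono) (auto intro: monoD[OF u_mono])
  then show ?thesis
    using assms unfolding zygmund_curve_def by (meson order_trans)
qed

lemma zygmund_curve_graph:
  assumes "continuous_on UNIV v" "C > 0"
    and zyg: "\<And>x h. h \<ge> 0 \<Longrightarrow> \<bar>v (x + h) - 2 * v x + v (x - h)\<bar> \<le> C * (u (x + h) - u (x - h))"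
  shows "zygmund_curve (\<lambda>t. Complex (u t) (v t)) (\<delta> + C)"
  unfolding zygmund_curve_def
proof (intro conjI allI impI)
  show "continuous_on UNIV (\<lambda>t. Complex (u t) (v t))"
    using u_continuous assms by (simp add: continuous_on_Complex)
  show "\<bar>u y - u x\<bar> \<le> norm (Complex (u y) (v y) - Complex (u x) (v x))" for x y
    using abs_Re_le_cmod[of "Complex (u y) (v y) - Complex (u x) (v x)"] by simp
  fix x h :: real assume h: "h \<ge> 0"
  have "norm (Complex (u (x + h)) (v (x + h)) - 2 *\<^sub>R Complex (u x) (v x) + Complex (u (x - h)) (v (x - h)))
      \<le> \<bar>u (x + h) - 2 * u x + u (x - h)\<bar> + \<bar>v (x + h) - 2 * v x + v (x - h)\<bar>"
    using cmod_le[of "Complex (u (x + h)) (v (x + h)) - 2 *\<^sub>R Complex (u x) (v x) + Complex (u (x - h)) (v (x - h))"]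
    by simp
  also have "\<dots> \<le> \<delta> * (u (x + h) - u (x - h)) + C * (u (x + h) - u (x - h))"
    using zygmund_curve_self zyg h by (intro add_mono) (auto simp: zygmund_curve_def)
  finally show "norm (Complex (u (x + h)) (v (x + h)) - 2 *\<^sub>R Complex (u x) (v x) + Complex (u (x - h)) (v (x - h)))
      \<le> (\<delta> + C) * (u (x + h) - u (x - h))" by (simp add: distrib_right)
qed (use \<delta>_pos assms in auto)

text \<open>The projection is a continuous bijection from a path-connected set onto the line, and
  such a map has a continuous inverse; surjectivity is that of \<open>u\<close>.\<close>

lemma graph_homeo:
  assumes "continuous_on UNIV v"
  shows "\<exists>g. homeomorphism (range (\<lambda>t. Complex (u t) (v t))) UNIV Re g"
proof (rule homeomorphism_into_1d)
  show "path_connected (range (\<lambda>t. Complex (u t) (v t)))"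
    using u_continuous assms
    by (intro path_connected_continuous_image) (auto simp: continuous_on_Complex)
  show "Re ` range (\<lambda>t. Complex (u t) (v t)) = UNIV"
    using u_surj by (simp add: image_image)
  show "inj_on Re (range (\<lambda>t. Complex (u t) (v t)))"
    using u_strict by (auto simp: inj_on_def strict_mono_eq)
qed (intro continuous_intros)

lemma graph_triple:
  assumes "a \<in> range \<Gamma>" "b \<in> range \<Gamma>" "x \<in> range \<Gamma>" "a \<noteq> x" "b \<noteq> x"
  obtains t h k :: real where "h \<noteq> 0" "k \<noteq> 0" "a = \<Gamma> (t + k)" "b = \<Gamma> (t + h)" "x = \<Gamma> t"
proof -
  obtain t p q where "x = \<Gamma> t" "a = \<Gamma> p" "b = \<Gamma> q" using assms by blast
  then show thesis using assms that[of "q - t" "p - t" t] by auto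
qed

lemma graph_qs_inequality:
  assumes "continuous_on UNIV v" "C > 0"
    and "\<And>x h. h \<ge> 0 \<Longrightarrow> \<bar>v (x + h) - 2 * v x + v (x - h)\<bar> \<le> C * (u (x + h) - u (x - h))"
  obtains \<eta> where "halfline_gauge \<eta>" "qs_inequality (range (\<lambda>t. Complex (u t) (v t))) Re \<eta>"
proof -
  let ?\<Gamma> = "\<lambda>t. Complex (u t) (v t)"
  obtain \<eta> where \<eta>: "halfline_gauge \<eta>" "\<And>x h k. h \<noteq> 0 \<Longrightarrow> k \<noteq> 0 \<Longrightarrow>
      \<bar>u (x + k) - u x\<bar> \<le> \<eta> (norm (?\<Gamma> (x + k) - ?\<Gamma> x) / norm (?\<Gamma> (x + h) - ?\<Gamma> x)) * \<bar>u (x + h) - u x\<bar>"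
  proof (rule zygmund_curve_qs)
    show "zygmund_curve u (\<delta> + C)"
      using zygmund_curve_weaken[OF zygmund_curve_self] \<open>C > 0\<close> by simp
    show "zygmund_curve ?\<Gamma> (\<delta> + C)" using assms by (rule zygmund_curve_graph)
  qed (use that in blast)
  have "qs_inequality (range ?\<Gamma>) Re \<eta>"
    unfolding qs_inequality_def
  proof (intro ballI impI)
    fix a b x
    assume abx: "a \<in> range ?\<Gamma>" "b \<in> range ?\<Gamma>" "x \<in> range ?\<Gamma>" and "a \<noteq> b \<and> a \<noteq> x \<and> b \<noteq> x"
    then have "a \<noteq> x" "b \<noteq> x" by auto
    then obtain t h k where hk: "h \<noteq> 0" "k \<noteq> 0"
      and eq: "a = ?\<Gamma> (t + k)" "b = ?\<Gamma> (t + h)" "x = ?\<Gamma> t"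
      by (rule graph_triple[OF abx])
    from \<eta>(2)[OF hk, of t]
    show "dist (Re x) (Re a) \<le> \<eta> (dist x a / dist x b) * dist (Re x) (Re b)"
      unfolding eq by (simp add: dist_norm norm_minus_commute abs_minus_commute)
  qed
  with \<eta>(1) show thesis by (rule that)
qed

lemma graph_s_quasisymmetric:
  fixes s :: real
  assumes "continuous_on UNIV v" "C > 0"
    and "\<And>x h. h \<ge> 0 \<Longrightarrow> \<bar>v (x + h) - 2 * v x + v (x - h)\<bar> \<le> C * (u (x + h) - u (x - h))"
    and "s > 0" "(\<delta> + C) * (3 + 2 * \<delta>) \<le> s / 8" "(\<delta> + C) * (3 + 2 * \<delta>) \<le> s ^ 3 / 16"
  shows "s_quasisymmetric s (range (\<lambda>t. Complex (u t) (v t))) Re"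
proof -
  let ?\<Gamma> = "\<lambda>t. Complex (u t) (v t)"
  have cu: "zygmund_curve u (\<delta> + C)"
    using zygmund_curve_weaken[OF zygmund_curve_self] \<open>C > 0\<close> by simp
  have c\<Gamma>: "zygmund_curve ?\<Gamma> (\<delta> + C)" using assms by (intro zygmund_curve_graph)
  obtain \<eta> where \<eta>: "halfline_gauge \<eta>" "qs_inequality (range ?\<Gamma>) Re \<eta>"
    using graph_qs_inequality[OF assms(1-3)] by blast
  show ?thesis
  proof (rule s_quasisymmetricI[OF \<open>s > 0\<close> \<eta>])
    fix a b x
    assume abx: "a \<in> range ?\<Gamma>" "b \<in> range ?\<Gamma>" "x \<in> range ?\<Gamma>" and ne: "a \<noteq> b" "a \<noteq> x" "b \<noteq> x"
      and le: "dist x a \<le> 2 / s * dist x b"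
    from ne(2,3) obtain t h k where hk: "h \<noteq> 0" "k \<noteq> 0"
      and eq: "a = ?\<Gamma> (t + k)" "b = ?\<Gamma> (t + h)" "x = ?\<Gamma> t"
      by (rule graph_triple[OF abx])
    from zygmund_curve_near[OF cu c\<Gamma> assms(4-6) hk, of t] le
    show "dist (Re x) (Re a) \<le> (dist x a / dist x b + s) * dist (Re x) (Re b)"
      unfolding eq by (simp add: dist_norm norm_minus_commute abs_minus_commute)
  qed
qed

end

section \<open>Passage from measures to primitives, and both claims\<close>

text \<open>The substance is strict monotonicity. An interval without mass passes this on to its
  neighbours of equal length by doubling, hence to the whole line, against the positive total
  mass.\<close>

lemma doubling_primitive_of_measure:
  assumes "radon_measure M" "emeasure M (space M) > 0" "doubling M \<delta>"
    and u: "\<And>a b. a < b \<Longrightarrow> u b - u a = measure M {a..b}"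
  shows "doubling_primitive u \<delta>"
proof -
  have "\<delta> > 0" and dbl: "\<And>a b c. a < b \<Longrightarrow> c - b = b - a \<Longrightarrow>
        u b - u a \<le> (1 + \<delta>) * (u c - u b) \<and> u c - u b \<le> (1 + \<delta>) * (u b - u a)"
    using assms(3) by (auto simp: doubling_def u)
  have mono: "u a \<le> u b" if "a \<le> b" for a b
  proof (cases "a = b")
    case False
    then have "u b - u a = measure M {a..b}" using that by (intro u) auto
    then show ?thesis using measure_nonneg[of M "{a..b}"] by linarith
  qed simp
  have "u a \<noteq> u b" if "a < b" for a b
  proof
    assume eq: "u a = u b"
    define d where "d = b - a"
    have "d > 0" using that by (simp add: d_def)
    have zero: "u (b + real n * d) = u a \<and> u (a - real n * d) = u a" for n
    proof (induction n)
      case (Suc n)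
      have "u (b + real (Suc n) * d) - u (b + real n * d) \<le> (1 + \<delta>) * (u (b + real n * d) - u (b + real n * d - d))"
        using dbl[of "b + real n * d - d" "b + real n * d" "b + real (Suc n) * d"] \<open>d > 0\<close>
        by (simp add: algebra_simps)
      \<comment> \<open>The preceding interval lies to the right of \<open>a\<close>, and
        \<open>u\<close> equals \<open>u a\<close> at its right end, so it carries no mass
        either.\<close>
      moreover have "u a \<le> u (b + real n * d - d)"
        using \<open>d > 0\<close> by (intro mono) (simp add: d_def)
      then have "(1 + \<delta>) * (u (b + real n * d) - u (b + real n * d - d)) \<le> 0"
        using Suc \<open>\<delta> > 0\<close> by (intro mult_nonneg_nonpos) auto
      moreover have "u a \<le> u (b + real (Suc n) * d)"
        using \<open>d > 0\<close> that by (intro mono) (simp add: add_increasing2)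
      ultimately have right: "u (b + real (Suc n) * d) = u a" using Suc by linarith
      have "u (a - real n * d) - u (a - real (Suc n) * d) \<le> (1 + \<delta>) * (u (a - real n * d + d) - u (a - real n * d))"
        using dbl[of "a - real (Suc n) * d" "a - real n * d" "a - real n * d + d"] \<open>d > 0\<close>
        by (simp add: algebra_simps)
      moreover have "u (a - real n * d + d) \<le> u b"
        using \<open>d > 0\<close> by (intro mono) (simp add: d_def)
      then have "(1 + \<delta>) * (u (a - real n * d + d) - u (a - real n * d)) \<le> 0"
        using Suc eq \<open>\<delta> > 0\<close> by (intro mult_nonneg_nonpos) auto
      moreover have "u (a - real (Suc n) * d) \<le> u a"
        using \<open>d > 0\<close> by (intro mono) simp
      ultimately show ?case using right Suc by linarith
    qed (use eq in simp)
    have const: "u y = u a" for y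
    proof -
      obtain n where n: "\<bar>y\<bar> + \<bar>a\<bar> + \<bar>b\<bar> < real n * d"
        using reals_Archimedean3[OF \<open>d > 0\<close>] by blast
      then have "u (a - real n * d) \<le> u y" "u y \<le> u (b + real n * d)"
        by (auto intro!: mono)
      then show ?thesis using zero by (metis order_antisym)
    qed
    have sets: "sets M = sets borel" and fin: "\<And>K. compact K \<Longrightarrow> emeasure M K < \<infinity>"
      using assms(1) by (auto simp: radon_measure_def)
    \<comment> \<open>\<open>Suc n\<close> keeps the interval nondegenerate. Finiteness on compact
      sets is what makes it null, because \<open>measure\<close> also takes the value 0 on sets of
      infinite mass.\<close>
    have "{- real (Suc n)..real (Suc n)} \<in> null_sets M" for n
    proof -
      have "measure M {- real (Suc n)..real (Suc n)} = 0"
        using u[of "- real (Suc n)" "real (Suc n)"] const[of "real (Suc n)"] const[of "- real (Suc n)"]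
        by simp
      then show ?thesis
        using fin[of "{- real (Suc n)..real (Suc n)}"] sets
        by (auto simp: null_sets_def emeasure_eq_ennreal_measure less_top[symmetric])
    qed
    then have "(\<Union>n. {- real (Suc n)..real (Suc n)}) \<in> null_sets M" by blast
    moreover have "(\<Union>n. {- real (Suc n)..real (Suc n)}) = UNIV"
    proof (intro equalityI subsetI UNIV_I)
      fix y :: real
      obtain n where "\<bar>y\<bar> < real n" using reals_Archimedean2 by blast
      then show "y \<in> (\<Union>n. {- real (Suc n)..real (Suc n)})" by (auto intro!: exI[of _ n])
    qed
    moreover have "space M = UNIV" using sets_eq_imp_space_eq[OF sets] by simp
    ultimately show False using assms(2) by auto
  qed
  then have "strict_mono u"
    using mono by (intro strict_monoI) (metis less_eq_real_def)
  then show ?thesis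
  proof (unfold_locales)
    fix x h :: real assume "h \<ge> 0"
    then show "u x - u (x - h) \<le> (1 + \<delta>) * (u (x + h) - u x)"
      and "u (x + h) - u x \<le> (1 + \<delta>) * (u x - u (x - h))"
      using dbl[of "x - h" x "x + h"] by (cases "h = 0"; simp)+
  qed (use \<open>\<delta> > 0\<close> in auto)
qed

lemma zygmund_bound_primitive:
  assumes "zygmund_bound M v C" and u: "\<And>a b. a < b \<Longrightarrow> u b - u a = measure M {a..b}" and "h \<ge> 0"
  shows "\<bar>v (x + h) - 2 * v x + v (x - h)\<bar> \<le> C * (u (x + h) - u (x - h))"
proof (cases "h = 0")
  case False
  then have "u (x + h) - u (x - h) = measure M {x - h..x + h}" using \<open>h \<ge> 0\<close> by (intro u) simp
  then show ?thesis using assms by (simp add: zygmund_bound_def)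
qed simp

theorem theorem1p2:
  fixes M :: "real measure" and \<delta> :: real and u v :: "real \<Rightarrow> real"
  assumes "radon_measure M" and "emeasure M (space M) > 0" and "doubling M \<delta>"
    and "\<And>a b. a < b \<Longrightarrow> u b - u a = measure M {a..b}"
    and "v \<in> zygmund_class M"
  shows "qs_graph ((\<lambda>t. Complex (u t) (v t)) ` UNIV) \<and>
    (\<forall>s>0. \<exists>\<epsilon>>0. \<forall>(N :: real measure) \<delta>' (u' :: real \<Rightarrow> real) (v' :: real \<Rightarrow> real).
           radon_measure N \<and> emeasure N (space N) > 0 \<and> doubling N \<delta>' \<and>
           (\<forall>a b. a < b \<longrightarrow> u' b - u' a = measure N {a..b}) \<and>
           v' \<in> zygmund_class N \<and> \<delta>' \<le> \<epsilon> \<and> zygmund_seminorm N v' \<le> \<epsilon>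
           \<longrightarrow> s_qs_graph s ((\<lambda>t. Complex (u' t) (v' t)) ` UNIV))"
proof (intro conjI allI impI)
  interpret doubling_primitive u \<delta>
    using assms(1-4) by (rule doubling_primitive_of_measure)
  obtain C where v: "continuous_on UNIV v" "C > 0" "zygmund_bound M v C"
    using assms(5) by (auto simp: zygmund_class_def)
  obtain \<eta> where "halfline_gauge \<eta>" "qs_inequality (range (\<lambda>t. Complex (u t) (v t))) Re \<eta>"
    using graph_qs_inequality[OF v(1,2) zygmund_bound_primitive[OF v(3) assms(4)]] by blast
  then show "qs_graph (range (\<lambda>t. Complex (u t) (v t)))"
    unfolding qs_graph_def quasisymmetric_def
    using graph_homeo[OF v(1)] halfline_gauge_homeo by blast
next
  fix s :: real assume "s > 0"
  define e where "e = min (s / 8) (s ^ 3 / 16)"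
  have "e > 0" using \<open>s > 0\<close> by (simp add: e_def)
  \<comment> \<open>The 15 is \<open>3 * 5\<close>: for
    \<open>\<delta>' \<le> \<epsilon> \<le> 1\<close> and \<open>C < 2 * \<epsilon>\<close>, the
    factors \<open>\<delta>' + C\<close> and \<open>3 + 2 * \<delta>'\<close> are at most
    \<open>3 * \<epsilon>\<close> and 5.\<close>
  define \<epsilon> where "\<epsilon> = min 1 (e / 15)"
  have \<epsilon>: "\<epsilon> > 0" "\<epsilon> \<le> 1" "15 * \<epsilon> \<le> e" using \<open>e > 0\<close> by (auto simp: \<epsilon>_def)
  have "s_qs_graph s (range (\<lambda>t. Complex (u' t) (v' t)))"
    if N: "radon_measure N" "emeasure N (space N) > 0" "doubling N \<delta>'"
      and u': "\<And>a b. a < b \<Longrightarrow> u' b - u' a = measure N {a..b}"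
      and v': "v' \<in> zygmund_class N" and small: "\<delta>' \<le> \<epsilon>" "zygmund_seminorm N v' \<le> \<epsilon>"
    for N :: "real measure" and \<delta>' and u' v' :: "real \<Rightarrow> real"
  proof -
    interpret doubling_primitive u' \<delta>'
      using N u' by (rule doubling_primitive_of_measure)
    have cont: "continuous_on UNIV v'" and ne: "{C. C > 0 \<and> zygmund_bound N v' C} \<noteq> {}"
      using v' by (auto simp: zygmund_class_def)
    \<comment> \<open>The factor 2 makes the inequality strict, so that an admissible constant below
      \<open>2 * \<epsilon>\<close> exists whether or not the infimum is attained.\<close>
    have "Inf {C. C > 0 \<and> zygmund_bound N v' C} < 2 * \<epsilon>"
      using small \<epsilon> by (simp add: zygmund_seminorm_def)
    then obtain C where C: "C > 0" "zygmund_bound N v' C" "C < 2 * \<epsilon>"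
      using cInf_lessD[OF ne] by auto
    have "(\<delta>' + C) * (3 + 2 * \<delta>') \<le> (3 * \<epsilon>) * 5"
      using small \<epsilon> C \<delta>_pos by (intro mult_mono) auto
    also have "\<dots> \<le> e" using \<epsilon> by simp
    finally have "s_quasisymmetric s (range (\<lambda>t. Complex (u' t) (v' t))) Re"
      using \<open>s > 0\<close>
      by (intro graph_s_quasisymmetric[OF cont C(1) zygmund_bound_primitive[OF C(2) u']])
        (auto simp: e_def)
    then show ?thesis
      unfolding s_qs_graph_def using graph_homeo[OF cont] by blast
  qed
  then show "\<exists>\<epsilon>>0. \<forall>(N :: real measure) \<delta>' (u' :: real \<Rightarrow> real) (v' :: real \<Rightarrow> real).
           radon_measure N \<and> emeasure N (space N) > 0 \<and> doubling N \<delta>' \<and>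
           (\<forall>a b. a < b \<longrightarrow> u' b - u' a = measure N {a..b}) \<and>
           v' \<in> zygmund_class N \<and> \<delta>' \<le> \<epsilon> \<and> zygmund_seminorm N v' \<le> \<epsilon>
           \<longrightarrow> s_qs_graph s (range (\<lambda>t. Complex (u' t) (v' t)))"
    using \<epsilon>(1) by (intro exI[of _ \<epsilon>]) blast
qed

end
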